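(* Let $n\ge 1$, let $d_1,\dots,d_n$ be nonnegative, square-integrable, possibly dependent real random variables on a common probability space, and let $z_1,\dots,z_n$ be mutually independent random variables such that $z_i$ has the same distribution as $d_i$ for every $i=1,\dots,n$. Then $$\frac12\,\mathbb{E}\left(\sum_{i=1}^n z_i\right)^2\le \mathbb{E}\left(\sum_{i=1}^n d_i\right)^2 .$$ Moreover, this inequality is sharp: $\frac12$ is the best universal constant, i.e. there is no constant $c>\frac12$ such that $c\,\mathbb{E}\left(\sum_{i=1}^n z_i\right)^2\le \mathbb{E}\left(\sum_{i=1}^n d_i\right)^2$ holds for all $n\ge1$ and all such $d_1,\dots,d_n$ and $z_1,\dots,z_n$.
   Context: The notation $\mathbb{E}(X)^2$ with the square outside the parentheses, as in $\mathbb{E}\left(\sum_i d_i\right)^2$, means $\mathbb{E}\big[\left(\sum_i d_i\right)^2\big]$. The variables $z_i$ may live on a different probability space from the $d_i$. *)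

theory Defs
  imports "HOL-Probability.Probability"
begin

text \<open>The variables \<open>d i\<close> live on \<open>M\<close> and may have an arbitrary joint law; the variables \<open>z i\<close> live
  on a possibly different space \<open>N\<close>. Measurability of the \<open>z i\<close> is part of \<^const>\<open>prob_space.indep_vars\<close>.\<close>

definition independent_copies ::
  "nat \<Rightarrow> 'a measure \<Rightarrow> (nat \<Rightarrow> 'a \<Rightarrow> real) \<Rightarrow> 'b measure \<Rightarrow> (nat \<Rightarrow> 'b \<Rightarrow> real) \<Rightarrow> bool" where
  "independent_copies n M d N z \<longleftrightarrow>
     prob_space M \<and> prob_space N \<and>
     (\<forall>i\<in>{1..n}. d i \<in> borel_measurable M \<and>
                 (\<forall>\<omega>\<in>space M. 0 \<le> d i \<omega>) \<and>
                 integrable M (\<lambda>\<omega>. (d i \<omega>)\<^sup>2)) \<and>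
     prob_space.indep_vars N (\<lambda>_. borel) z {1..n} \<and>
     (\<forall>i\<in>{1..n}. distr N borel (z i) = distr M borel (d i))"

text \<open>HOL cannot quantify over types inside a formula, so statements about the failure of an inequality
  for some probability space have to fix a sample type. The type \<^typ>\<open>nat \<Rightarrow> real\<close> is no restriction:
  the joint law of any finite family of real random variables is realised by the coordinate functions on it.\<close>

type_synonym sample = "nat \<Rightarrow> real"

end

theory Submission
  imports Defs
begin

text \<open>Independence gives
  \<open>E(\<Sum>z\<^sub>i)\<^sup>2 = (\<Sum>E z\<^sub>i)\<^sup>2 + \<Sum>E z\<^sub>i\<^sup>2 - \<Sum>(E z\<^sub>i)\<^sup>2\<close>, which depends on the marginals only.
  Each of the first two terms is at most \<open>E(\<Sum>d\<^sub>i)\<^sup>2\<close>: the first by Jensen, the second because the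
  \<open>d\<^sub>i\<close> are nonnegative. Both bounds are equalities when the \<open>d\<^sub>i\<close> are the indicators of a partition
  into \<open>n\<close> events of probability \<open>1/n\<close>, and then the ratio of the two second moments is \<open>1 / (2 - 1/n)\<close>.\<close>

text \<open>The product is dominated by the sum of the two squares, which is integrable.\<close>

lemma integrable_mult_square_integrable:
  fixes f g :: "'a \<Rightarrow> real"
  assumes [measurable]: "f \<in> borel_measurable M" "g \<in> borel_measurable M"
    and "integrable M (\<lambda>x. (f x)\<^sup>2)" "integrable M (\<lambda>x. (g x)\<^sup>2)"
  shows "integrable M (\<lambda>x. f x * g x)"
proof (rule Bochner_Integration.integrable_bound)
  show "integrable M (\<lambda>x. (f x)\<^sup>2 + (g x)\<^sup>2)"
    using assms by simp
  have "\<bar>a * b\<bar> \<le> a\<^sup>2 + b\<^sup>2" for a b :: real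
    using sum_squares_bound[of "\<bar>a\<bar>" "\<bar>b\<bar>"] mult_nonneg_nonneg[OF abs_ge_zero[of a] abs_ge_zero[of b]]
    unfolding abs_mult power2_abs by linarith
  then show "AE x in M. norm (f x * g x) \<le> norm ((f x)\<^sup>2 + (g x)\<^sup>2)"
    by simp
qed measurable

lemma square_sum_eq_sum_sum:
  fixes x :: "'i \<Rightarrow> 'a::comm_semiring_1"
  shows "(\<Sum>i\<in>I. x i)\<^sup>2 = (\<Sum>i\<in>I. \<Sum>j\<in>I. x i * x j)"
  by (simp add: power2_eq_square sum_product)

lemma integrable_square_sum:
  fixes X :: "'i \<Rightarrow> 'a \<Rightarrow> real"
  assumes "\<And>i. i \<in> I \<Longrightarrow> X i \<in> borel_measurable M"
    and "\<And>i. i \<in> I \<Longrightarrow> integrable M (\<lambda>x. (X i x)\<^sup>2)"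
  shows "integrable M (\<lambda>x. (\<Sum>i\<in>I. X i x)\<^sup>2)"
  unfolding square_sum_eq_sum_sum
  by (intro Bochner_Integration.integrable_sum integrable_mult_square_integrable assms)

lemma sum_squares_le_square_sum:
  fixes x :: "'i \<Rightarrow> 'a::linordered_idom"
  assumes "finite I" "\<And>i. i \<in> I \<Longrightarrow> 0 \<le> x i"
  shows "(\<Sum>i\<in>I. (x i)\<^sup>2) \<le> (\<Sum>i\<in>I. x i)\<^sup>2"
  \<comment> \<open>Distribute only one factor of the square: the right side becomes the sum of
    \<open>x i * sum x I\<close>, and nonnegativity gives \<open>x i\<close> \<le>
    \<open>sum x I\<close>, so the comparison is termwise.\<close>
  unfolding power2_eq_square[of "sum x I"] sum_distrib_right
  by (auto simp: power2_eq_square intro!: sum_mono mult_left_mono member_le_sum assms)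

text \<open>The difference of the two sides is the variance of \<open>X\<close>. This is the only
  case of Jensen's inequality used.\<close>

lemma (in prob_space) square_expectation_le:
  fixes X :: "'a \<Rightarrow> real"
  assumes "X \<in> borel_measurable M" "integrable M (\<lambda>x. (X x)\<^sup>2)"
  shows "(expectation X)\<^sup>2 \<le> expectation (\<lambda>x. (X x)\<^sup>2)"
  using variance_eq[OF square_integrable_imp_integrable[OF assms] assms(2)] variance_positive[of X]
  by simp

lemma (in prob_space) expectation_square_sum_indep_vars:
  fixes X :: "'i \<Rightarrow> 'a \<Rightarrow> real"
  assumes "finite I" and indep: "indep_vars (\<lambda>_. borel) X I"
    and sq: "\<And>i. i \<in> I \<Longrightarrow> integrable M (\<lambda>x. (X i x)\<^sup>2)"
  shows "expectation (\<lambda>x. (\<Sum>i\<in>I. X i x)\<^sup>2) =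
    (\<Sum>i\<in>I. expectation (X i))\<^sup>2 + (\<Sum>i\<in>I. expectation (\<lambda>x. (X i x)\<^sup>2))
      - (\<Sum>i\<in>I. (expectation (X i))\<^sup>2)"
proof -
  let ?E = "\<lambda>i. expectation (X i)"
  have X: "X i \<in> borel_measurable M" if "i \<in> I" for i
    using indep that by (auto simp: indep_vars_def)
  have int: "integrable M (X i)" if "i \<in> I" for i
    using square_integrable_imp_integrable[OF X sq] that by blast
  \<comment> \<open>Off the diagonal, independence factors the expectation. Writing the diagonal
    value as the product of means plus a correction lets the double sum split into a full square and
    a single sum.\<close>
  have prod: "expectation (\<lambda>x. X i x * X j x) =
      ?E i * ?E j + (if i = j then expectation (\<lambda>x. (X i x)\<^sup>2) - (?E i)\<^sup>2 else 0)"
    if "i \<in> I" "j \<in> I" for i j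
  proof (cases "i = j")
    case False
    have "indep_vars (\<lambda>_. borel) X {i, j}"
      using that by (intro indep_vars_subset[OF indep]) simp
    moreover have "integrable M (X k)" if "k \<in> {i, j}" for k
      using that \<open>i \<in> I\<close> \<open>j \<in> I\<close> int by blast
    ultimately have "expectation (\<lambda>x. \<Prod>k\<in>{i, j}. X k x) = (\<Prod>k\<in>{i, j}. ?E k)"
      by (intro indep_vars_lebesgue_integral) simp_all
    with False show ?thesis
      by simp
  qed (simp add: power2_eq_square)
  have "expectation (\<lambda>x. (\<Sum>i\<in>I. X i x)\<^sup>2) = (\<Sum>i\<in>I. \<Sum>j\<in>I. expectation (\<lambda>x. X i x * X j x))"
    unfolding square_sum_eq_sum_sum using X sq
    by (simp add: Bochner_Integration.integral_sum Bochner_Integration.integrable_sum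
        integrable_mult_square_integrable)
  also have "\<dots> = (\<Sum>i\<in>I. \<Sum>j\<in>I. ?E i * ?E j) +
      (\<Sum>i\<in>I. expectation (\<lambda>x. (X i x)\<^sup>2) - (?E i)\<^sup>2)"
    using \<open>finite I\<close> by (simp add: prod sum.distrib)
  finally show ?thesis
    by (simp add: square_sum_eq_sum_sum[of ?E] sum_subtractf)
qed

text \<open>Expanding the left side by independence leaves only first and second moments of single
  \<open>z i\<close>, and these agree with those of \<open>d i\<close> because the laws agree. The
  formula serves both the upper bound and the extremal example.\<close>

lemma independent_copies_second_moment:
  assumes "independent_copies n M d N z"
  shows "(\<integral>\<omega>. (\<Sum>i=1..n. z i \<omega>)\<^sup>2 \<partial>N) =
    (\<Sum>i=1..n. \<integral>\<omega>. d i \<omega> \<partial>M)\<^sup>2 + (\<Sum>i=1..n. \<integral>\<omega>. (d i \<omega>)\<^sup>2 \<partial>M)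
      - (\<Sum>i=1..n. (\<integral>\<omega>. d i \<omega> \<partial>M)\<^sup>2)"
proof -
  interpret N: prob_space N
    using assms by (simp add: independent_copies_def)
  have d: "d i \<in> borel_measurable M" "integrable M (\<lambda>\<omega>. (d i \<omega>)\<^sup>2)"
    and distr: "distr N borel (z i) = distr M borel (d i)" if "i \<in> {1..n}" for i
    using assms that by (auto simp: independent_copies_def)
  have indep: "N.indep_vars (\<lambda>_. borel) z {1..n}"
    using assms by (simp add: independent_copies_def)
  then have z: "z i \<in> borel_measurable N" if "i \<in> {1..n}" for i
    using that by (auto simp: N.indep_vars_def)
  \<comment> \<open>Both integrals are integrals of \<open>f\<close> against the common law on the
    real line; the identity and the square are the instances used below.\<close>
  have eq: "(\<integral>\<omega>. f (z i \<omega>) \<partial>N) = (\<integral>\<omega>. f (d i \<omega>) \<partial>M)"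
    and int: "integrable N (\<lambda>\<omega>. f (z i \<omega>)) \<longleftrightarrow> integrable M (\<lambda>\<omega>. f (d i \<omega>))"
    if "i \<in> {1..n}" "f \<in> borel_measurable borel" for i and f :: "real \<Rightarrow> real"
    using integral_distr[OF z that(2)] integral_distr[OF d(1) that(2)]
      integrable_distr_eq[OF z that(2)] integrable_distr_eq[OF d(1) that(2)] distr that(1)
    by simp_all
  have sq: "integrable N (\<lambda>\<omega>. (z i \<omega>)\<^sup>2)" if "i \<in> {1..n}" for i
    using int[of i "\<lambda>x. x\<^sup>2"] d that by simp
  show ?thesis
    by (subst N.expectation_square_sum_indep_vars[OF _ indep sq])
      (simp_all add: eq[of _ "\<lambda>x. x"] eq[of _ "\<lambda>x. x\<^sup>2"])
qed

lemma independent_copies_half_bound: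
  assumes copies: "independent_copies n M d N z"
  shows "1 / 2 * (\<integral>\<omega>. (\<Sum>i=1..n. z i \<omega>)\<^sup>2 \<partial>N) \<le> (\<integral>\<omega>. (\<Sum>i=1..n. d i \<omega>)\<^sup>2 \<partial>M)"
proof -
  interpret M: prob_space M
    using copies by (simp add: independent_copies_def)
  have d: "d i \<in> borel_measurable M" "integrable M (\<lambda>\<omega>. (d i \<omega>)\<^sup>2)"
    and nonneg: "\<And>\<omega>. \<omega> \<in> space M \<Longrightarrow> 0 \<le> d i \<omega>" if "i \<in> {1..n}" for i
    using copies that by (auto simp: independent_copies_def)
  have int: "integrable M (d i)" if "i \<in> {1..n}" for i
    using M.square_integrable_imp_integrable[OF d] that by blast
  have intS: "integrable M (\<lambda>\<omega>. (\<Sum>i=1..n. d i \<omega>)\<^sup>2)"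
    by (intro integrable_square_sum d)
  have "(\<Sum>i=1..n. \<integral>\<omega>. d i \<omega> \<partial>M)\<^sup>2 = (\<integral>\<omega>. (\<Sum>i=1..n. d i \<omega>) \<partial>M)\<^sup>2"
    using int by (simp add: Bochner_Integration.integral_sum)
  also have "\<dots> \<le> (\<integral>\<omega>. (\<Sum>i=1..n. d i \<omega>)\<^sup>2 \<partial>M)"
    by (intro M.square_expectation_le intS borel_measurable_sum d)
  finally have 1: "(\<Sum>i=1..n. \<integral>\<omega>. d i \<omega> \<partial>M)\<^sup>2 \<le> (\<integral>\<omega>. (\<Sum>i=1..n. d i \<omega>)\<^sup>2 \<partial>M)" .
  have "(\<Sum>i=1..n. \<integral>\<omega>. (d i \<omega>)\<^sup>2 \<partial>M) = (\<integral>\<omega>. (\<Sum>i=1..n. (d i \<omega>)\<^sup>2) \<partial>M)"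
    using d by (simp add: Bochner_Integration.integral_sum)
  also have "\<dots> \<le> (\<integral>\<omega>. (\<Sum>i=1..n. d i \<omega>)\<^sup>2 \<partial>M)"
    by (intro integral_mono intS sum_squares_le_square_sum Bochner_Integration.integrable_sum d)
      (auto intro: nonneg)
  finally have 2: "(\<Sum>i=1..n. \<integral>\<omega>. (d i \<omega>)\<^sup>2 \<partial>M) \<le> (\<integral>\<omega>. (\<Sum>i=1..n. d i \<omega>)\<^sup>2 \<partial>M)" .
  have "0 \<le> (\<Sum>i=1..n. (\<integral>\<omega>. d i \<omega> \<partial>M)\<^sup>2)"
    by (simp add: sum_nonneg)
  moreover have "1 / 2 * (a + b - c) \<le> s" if "a \<le> s" "b \<le> s" "0 \<le> c" for a b c s :: real
    using that by simp
  ultimately show ?thesis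
    unfolding independent_copies_second_moment[OF copies] using 1 2 by blast
qed

text \<open>On the discrete sigma-algebra of a pmf, every map into a \<open>K\<close> with full
  space is measurable, so image measures compose without side conditions.\<close>

lemma distr_map_pmf:
  assumes "space K = UNIV"
  shows "distr (measure_pmf (map_pmf f p)) K g = distr (measure_pmf p) K (\<lambda>x. g (f x))"
  unfolding map_pmf_rep_eq using assms by (subst distr_distr) (auto simp: o_def)

text \<open>The coordinates under the product of the marginal laws are independent copies. The
  default value 0 fixes the coordinates outside \<open>{1..n}\<close>.\<close>

lemma independent_copies_Pi_pmf:
  assumes "\<And>i x. 0 \<le> d i x"
    and "\<And>i. i \<in> {1..n} \<Longrightarrow> integrable (measure_pmf p) (\<lambda>x. (d i x)\<^sup>2)"
  shows "independent_copies n (measure_pmf p) d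
    (measure_pmf (Pi_pmf {1..n} 0 (\<lambda>i. map_pmf (d i) p))) (\<lambda>i \<omega>. \<omega> i)"
proof -
  let ?P = "Pi_pmf {1..n} 0 (\<lambda>i. map_pmf (d i) p)"
  have "distr (measure_pmf ?P) borel (\<lambda>\<omega>. \<omega> i) = distr (measure_pmf p) borel (d i)"
    if "i \<in> {1..n}" for i
    \<comment> \<open>Both laws are the image of \<open>map_pmf (d i) p\<close> under the identity
      map into \<open>borel\<close>.\<close>
    using distr_map_pmf[of borel "\<lambda>\<omega>. \<omega> i" ?P "\<lambda>x. x"] distr_map_pmf[of borel "d i" p "\<lambda>x. x"] that
    by (simp add: Pi_pmf_component)
  moreover have "prob_space.indep_vars (measure_pmf ?P) (\<lambda>_. borel) (\<lambda>i \<omega>. \<omega> i) {1..n}"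
    \<comment> \<open>Composing with the identity passes from independence for the discrete
      sigma-algebra to independence for the Borel one.\<close>
    using prob_space.indep_vars_compose2[OF measure_pmf.prob_space_axioms
        indep_vars_Pi_pmf[of "{1..n}" 0 "\<lambda>i. map_pmf (d i) p"], of "\<lambda>_ x. x" "\<lambda>_. borel"] by simp
  ultimately show ?thesis
    using assms by (simp add: independent_copies_def measure_pmf.prob_space_axioms)
qed

lemma sharp_example:
  fixes n :: nat
  assumes "n \<ge> 1"
  obtains M N :: "sample measure" and d z where "independent_copies n M d N z"
    "(\<integral>\<omega>. (\<Sum>i=1..n. d i \<omega>)\<^sup>2 \<partial>M) = 1" "(\<integral>\<omega>. (\<Sum>i=1..n. z i \<omega>)\<^sup>2 \<partial>N) = 2 - 1 / real n"
proof -
  \<comment> \<open>A uniform \<open>k\<close> in \<open>{1..n}\<close> is encoded as a constant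
    sequence to fit the type \<open>sample\<close>. Then \<open>d i\<close> indicates the event
    \<open>k = i\<close>, and exactly one of these events occurs, so the sum of the
    \<open>d i\<close> is constantly 1.\<close>
  define p :: "sample pmf" where "p = map_pmf (\<lambda>k _. real k) (pmf_of_set {1..n})"
  define d :: "nat \<Rightarrow> sample \<Rightarrow> real" where "d = (\<lambda>i \<omega>. of_bool (\<omega> 0 = real i))"
  have ne: "{1..n} \<noteq> {}" using assms by auto
  have sq: "(d i \<omega>)\<^sup>2 = d i \<omega>" for i \<omega>
    by (simp add: d_def)
  have "finite (set_pmf p)"
    using ne by (simp add: p_def)
  then have copies: "independent_copies n (measure_pmf p) d
      (measure_pmf (Pi_pmf {1..n} 0 (\<lambda>i. map_pmf (d i) p))) (\<lambda>i \<omega>. \<omega> i)"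
    by (intro independent_copies_Pi_pmf integrable_measure_pmf_finite) (simp_all add: d_def)
  have S: "(\<integral>\<omega>. (\<Sum>i=1..n. d i \<omega>)\<^sup>2 \<partial>measure_pmf p) = 1"
  proof -
    have "(\<Sum>i=1..n. d i (\<lambda>_. real k)) = 1" if "k \<in> {1..n}" for k
      using that by (simp add: d_def of_bool_def)
    then show ?thesis
      using ne assms by (simp add: p_def integral_pmf_of_set)
  qed
  have E: "(\<integral>\<omega>. d i \<omega> \<partial>measure_pmf p) = 1 / n" if "i \<in> {1..n}" for i
    using ne that by (simp add: p_def d_def integral_pmf_of_set of_bool_def)
  \<comment> \<open>Indicators equal their squares, so all first and second moments are
    \<open>1 / n\<close> and the three terms are 1, 1 and
    \<open>n * (1 / n)\<^sup>2\<close>.\<close>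
  have "(\<Sum>i=1..n. \<integral>\<omega>. d i \<omega> \<partial>measure_pmf p)\<^sup>2 + (\<Sum>i=1..n. \<integral>\<omega>. (d i \<omega>)\<^sup>2 \<partial>measure_pmf p)
      - (\<Sum>i=1..n. (\<integral>\<omega>. d i \<omega> \<partial>measure_pmf p)\<^sup>2) = 2 - 1 / real n"
    unfolding sq using assms by (simp add: E power2_eq_square)
  then show thesis
    using that[OF copies S] independent_copies_second_moment[OF copies] by simp
qed

theorem theorem2p1:
  shows "(\<forall>n (M :: 'a measure) d (N :: 'b measure) z.
            n \<ge> 1 \<longrightarrow> independent_copies n M d N z \<longrightarrow>
              1 / 2 * (\<integral>\<omega>. (\<Sum>i=1..n. z i \<omega>)\<^sup>2 \<partial>N) \<le> (\<integral>\<omega>. (\<Sum>i=1..n. d i \<omega>)\<^sup>2 \<partial>M)) \<and>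
         \<not> (\<exists>c::real. c > 1 / 2 \<and>
            (\<forall>n (M :: sample measure) d (N :: sample measure) z.
               n \<ge> 1 \<longrightarrow> independent_copies n M d N z \<longrightarrow>
                 c * (\<integral>\<omega>. (\<Sum>i=1..n. z i \<omega>)\<^sup>2 \<partial>N) \<le> (\<integral>\<omega>. (\<Sum>i=1..n. d i \<omega>)\<^sup>2 \<partial>M)))"
proof (intro conjI allI impI notI)
  fix n and M :: "'a measure" and d and N :: "'b measure" and z
  assume "independent_copies n M d N z"
  then show "1 / 2 * (\<integral>\<omega>. (\<Sum>i=1..n. z i \<omega>)\<^sup>2 \<partial>N) \<le> (\<integral>\<omega>. (\<Sum>i=1..n. d i \<omega>)\<^sup>2 \<partial>M)"
    by (rule independent_copies_half_bound)
next
  assume "\<exists>c::real. c > 1 / 2 \<and>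
            (\<forall>n (M :: sample measure) d (N :: sample measure) z.
               n \<ge> 1 \<longrightarrow> independent_copies n M d N z \<longrightarrow>
                 c * (\<integral>\<omega>. (\<Sum>i=1..n. z i \<omega>)\<^sup>2 \<partial>N) \<le> (\<integral>\<omega>. (\<Sum>i=1..n. d i \<omega>)\<^sup>2 \<partial>M))"
  then obtain c :: real where c: "c > 1 / 2" and
    bound: "\<And>n (M :: sample measure) d (N :: sample measure) z.
      n \<ge> 1 \<Longrightarrow> independent_copies n M d N z \<Longrightarrow>
        c * (\<integral>\<omega>. (\<Sum>i=1..n. z i \<omega>)\<^sup>2 \<partial>N) \<le> (\<integral>\<omega>. (\<Sum>i=1..n. d i \<omega>)\<^sup>2 \<partial>M)"
    by blast
  have "c * (2 - 1 / real n) \<le> 1" if "n \<ge> 1" for n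
    using sharp_example[OF that] bound[OF that] by metis
  \<comment> \<open>No single \<open>n\<close> refutes every \<open>c\<close> above 1/2; the limit
    of the examples does, since it forces \<open>2 * c\<close> \<le> 1.\<close>
  moreover have "(\<lambda>n. c * (2 - 1 / real n)) \<longlonglongrightarrow> c * (2 - 0)"
    by (intro tendsto_intros lim_1_over_n)
  ultimately have "c * (2 - 0) \<le> 1"
    by (intro LIMSEQ_le_const2) auto
  with c show False by simp
qed

end
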